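(* The following two assertions are equivalent: (1) for all $m,n\in\mathbb N$ there exist $i,j\ge 0$ with $T^i(m)=T^j(n)$; (2) for every $K\ge1$ there exists $t\ge0$ such that $|S_K(t)|=1$.
   Context: $\mathbb N=\{1,2,3,\dots\}$; $\tau(n)$ is the number of positive divisors of $n$; $T(n)=n+\tau(n)$, and $T^i$ is the $i$-th iterate. For $k\ge1$ let $I_k=[k^2,(k+1)^2)\cap\mathbb N$. Every $T$-orbit is strictly increasing, and if $n\in I_k$ then $T(n)\in I_k\cup I_{k+1}$. The annular transfer map $\mathcal A_k:\{0,1,\dots,2k\}\to\{0,1,\dots,2k+2\}$ is defined as follows: for $0\le r\le 2k$, let $s\ge1$ be minimal with $T^s(k^2+r)\ge (k+1)^2$; then $\mathcal A_k(r)=T^s(k^2+r)-(k+1)^2$. For a set $A$ of offsets, $\mathcal A_k(A)=\{\mathcal A_k(r):r\in A\}$. For $K\ge1$ define recursively $S_K(0)=\{0,1,\dots,2K\}$ and $S_K(t+1)=\mathcal A_{K+t}(S_K(t))$ for $t\ge0$. *)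

theory Defs
  imports Main
begin

definition tau :: "nat \<Rightarrow> nat" where
  "tau n = card {d. d dvd n}"

definition T :: "nat \<Rightarrow> nat" where
  "T n = n + tau n"

definition exit_time :: "nat \<Rightarrow> nat \<Rightarrow> nat" where
  "exit_time k r = (LEAST s. 1 \<le> s \<and> (k + 1)^2 \<le> (T ^^ s) (k^2 + r))"

text \<open>
  The map \<open>annular_transfer k\<close> is only meaningful for \<open>k \<ge> 1\<close> and \<open>r \<le> 2 * k\<close>. There the exit
  time exists and the truncated subtraction is exact, see \<open>exit_time_props\<close> below.
\<close>

definition annular_transfer :: "nat \<Rightarrow> nat \<Rightarrow> nat" where
  "annular_transfer k r = (T ^^ exit_time k r) (k^2 + r) - (k + 1)^2"

primrec S :: "nat \<Rightarrow> nat \<Rightarrow> nat set" where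
  "S K 0 = {0..2 * K}"
| "S K (Suc t) = annular_transfer (K + t) ` S K t"

lemma T_gt:
  assumes "1 \<le> n"
  shows "n < T n"
proof -
  have "finite {d. d dvd n}"
    using assms by (intro finite_divisors_nat) simp
  moreover have "n \<in> {d. d dvd n}"
    by simp
  ultimately have "0 < card {d. d dvd n}"
    by (metis card_gt_0_iff empty_iff)
  then show ?thesis
    by (simp add: T_def tau_def)
qed

lemma T_iterate_ge:
  assumes "1 \<le> n"
  shows "n + s \<le> (T ^^ s) n"
proof (induction s)
  case (Suc s)
  have "(T ^^ s) n < T ((T ^^ s) n)"
    using Suc assms by (intro T_gt) simp
  with Suc show ?case
    by simp
qed simp

lemma exit_time_props:
  assumes "1 \<le> k"
  shows "1 \<le> exit_time k r"
    and "(k + 1)^2 \<le> (T ^^ exit_time k r) (k^2 + r)"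
proof -
  have "1 \<le> k^2 + r"
    using assms by (simp add: Suc_le_eq)
  from T_iterate_ge[OF this, of "(k + 1)^2"]
  have "1 \<le> (k + 1)^2 \<and> (k + 1)^2 \<le> (T ^^ ((k + 1)^2)) (k^2 + r)"
    by simp
  from LeastI[of "\<lambda>s. 1 \<le> s \<and> (k + 1)^2 \<le> (T ^^ s) (k^2 + r)", OF this]
  show "1 \<le> exit_time k r" and "(k + 1)^2 \<le> (T ^^ exit_time k r) (k^2 + r)"
    by (simp_all add: exit_time_def)
qed

end

theory Submission
  imports Defs
begin

text \<open>
  The shifted set \<open>(K + t)\<^sup>2 + S K t\<close> consists of the points at which the orbits starting in
  \<open>[K\<^sup>2, (K + 1)\<^sup>2)\<close> first reach level \<open>(K + t)\<^sup>2\<close>. This rests on the estimate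
  \<open>\<tau>(z) \<le> 2 k\<close> for \<open>z < k\<^sup>2\<close>: no orbit jumps over a whole annulus, so the first
  point at or above \<open>k\<^sup>2\<close> lies below \<open>(k + 1)\<^sup>2\<close>, and entering successive annuli one
  after the other is the same as entering the last one directly
  (\<open>first_at_least_less\<close>, \<open>first_at_least_funpow\<close>, \<open>shifted_S_eq\<close>).

  Hence \<open>S K t\<close> is a singleton exactly if all orbits starting in the annulus of \<open>K\<close> enter
  the annulus of \<open>K + t\<close> at one common point. If any two orbits meet, then the finitely many
  orbits starting in that annulus share a point \<open>p\<close>, and beyond \<open>p\<close> they all coincide;
  so they enter every annulus above \<open>p\<close> at the same place. Conversely, two given orbits enter
  a common annulus \<open>K\<close> once \<open>K\<close> is large, and a singleton \<open>S K t\<close> forces them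
  to meet no later than on entering the annulus of \<open>K + t\<close>.
\<close>

text \<open>Of two complementary divisors of \<open>z < k\<^sup>2\<close>, one is smaller than \<open>k\<close>.\<close>

lemma tau_le_of_less_square:
  assumes "1 \<le> z" "z < k\<^sup>2"
  shows "tau z \<le> 2 * k"
proof -
  have "{d. d dvd z} \<subseteq> {..<k} \<union> (\<lambda>e. z div e) ` {..<k}"
  proof
    fix d assume "d \<in> {d. d dvd z}"
    then obtain e where e: "z = d * e" by (auto elim: dvdE)
    show "d \<in> {..<k} \<union> (\<lambda>e. z div e) ` {..<k}"
    proof (cases "d < k")
      case False
      have "e < k"
      proof (rule ccontr)
        assume "\<not> e < k"
        with False have "k * k \<le> d * e" by (intro mult_le_mono) auto
        with assms e show False by (simp add: power2_eq_square)
      qed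
      moreover have "d = z div e" using e assms by auto
      ultimately show ?thesis by blast
    qed simp
  qed
  then have "tau z \<le> card ({..<k} \<union> (\<lambda>e. z div e) ` {..<k})"
    unfolding tau_def by (intro card_mono) auto
  also have "\<dots> \<le> card {..<k} + card ((\<lambda>e. z div e) ` {..<k})"
    by (rule card_Un_le)
  also have "\<dots> \<le> card {..<k} + card {..<k}"
    by (intro add_left_mono card_image_le) simp
  finally show ?thesis by simp
qed

lemma strict_mono_T_funpow:
  assumes "1 \<le> n"
  shows "strict_mono (\<lambda>s. (T ^^ s) n)"
proof (rule strict_mono_Suc_iff[THEN iffD2], rule allI)
  fix s
  have "1 \<le> (T ^^ s) n" using T_iterate_ge[OF assms, of s] assms by simp
  from T_gt[OF this] show "(T ^^ s) n < (T ^^ Suc s) n" by simp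
qed

text \<open>
  Orbits increase, so the least orbit point at or above a level is also the first one in time.
  Speaking of the least value rather than of the least time makes it depend only on the part of the
  orbit above the level.
\<close>

definition first_at_least :: "nat \<Rightarrow> nat \<Rightarrow> nat" where
  "first_at_least N n = (LEAST y. N \<le> y \<and> (\<exists>s. y = (T ^^ s) n))"

lemma first_at_least_props:
  assumes "1 \<le> n"
  shows "N \<le> first_at_least N n" "\<exists>s. first_at_least N n = (T ^^ s) n"
proof -
  have "N \<le> (T ^^ N) n \<and> (\<exists>s. (T ^^ N) n = (T ^^ s) n)"
    using T_iterate_ge[OF assms, of N] by auto
  from LeastI[of "\<lambda>y. N \<le> y \<and> (\<exists>s. y = (T ^^ s) n)", OF this]
  show "N \<le> first_at_least N n" "\<exists>s. first_at_least N n = (T ^^ s) n"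
    by (simp_all add: first_at_least_def)
qed

lemma first_at_least_le:
  assumes "N \<le> (T ^^ s) n"
  shows "first_at_least N n \<le> (T ^^ s) n"
  unfolding first_at_least_def by (rule Least_le) (use assms in blast)

text \<open>
  An orbit may be restarted at any of its points up to the level \<open>N\<close>: what is dropped lies
  below \<open>N\<close>.
\<close>

lemma first_at_least_funpow:
  assumes "1 \<le> n" "(T ^^ i) n \<le> N"
  shows "first_at_least N ((T ^^ i) n) = first_at_least N n"
proof -
  have "(N \<le> y \<and> (\<exists>s. y = (T ^^ s) ((T ^^ i) n))) \<longleftrightarrow> (N \<le> y \<and> (\<exists>s. y = (T ^^ s) n))" for y
  proof (intro conj_cong refl iffI)
    assume "\<exists>s. y = (T ^^ s) ((T ^^ i) n)"
    then show "\<exists>s. y = (T ^^ s) n" by (metis comp_apply funpow_add)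
  next
    assume "N \<le> y" and "\<exists>s. y = (T ^^ s) n"
    then obtain s where s: "y = (T ^^ s) n" by blast
    with \<open>N \<le> y\<close> assms have "(T ^^ i) n \<le> (T ^^ s) n" by simp
    then have "i \<le> s" by (simp add: strict_mono_less_eq[OF strict_mono_T_funpow[OF assms(1)]])
    then have "y = (T ^^ (s - i)) ((T ^^ i) n)"
      using s by (metis comp_apply funpow_add le_add_diff_inverse2)
    then show "\<exists>s. y = (T ^^ s) ((T ^^ i) n)" by blast
  qed
  then show ?thesis by (simp add: first_at_least_def)
qed

text \<open>
  No annulus is skipped: the last orbit point \<open>z\<close> below \<open>k\<^sup>2\<close> moves by
  \<open>\<tau>(z) \<le> 2 k\<close>, which is less than the width of the annulus of \<open>k\<close>.
\<close>

lemma first_at_least_less: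
  assumes "1 \<le> n" "n < (k + 1)\<^sup>2"
  shows "first_at_least (k\<^sup>2) n < (k + 1)\<^sup>2"
proof -
  obtain s where s: "first_at_least (k\<^sup>2) n = (T ^^ s) n"
    using first_at_least_props(2)[OF assms(1)] by blast
  show ?thesis
  proof (cases s)
    case 0
    with s assms show ?thesis by simp
  next
    case (Suc u)
    let ?z = "(T ^^ u) n"
    have "?z < (T ^^ s) n"
      using strict_monoD[OF strict_mono_T_funpow[OF assms(1)], of u s] Suc by simp
    then have "?z < k\<^sup>2"
      using first_at_least_le[of "k\<^sup>2" u n] s by linarith
    moreover have "1 \<le> ?z" using T_iterate_ge[OF assms(1), of u] assms(1) by simp
    ultimately have "T ?z < k\<^sup>2 + 2 * k"
      using tau_le_of_less_square[of ?z k] by (simp add: T_def)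
    with s Suc show ?thesis by (simp add: power2_eq_square)
  qed
qed

text \<open>
  The exit time is at least \<open>1\<close> by definition, so it is the time of first entry only for
  starting points below the level, that is, for \<open>r \<le> 2 * k\<close>.
\<close>

lemma annular_transfer_eq:
  assumes "1 \<le> k" "k\<^sup>2 + r < (k + 1)\<^sup>2"
  shows "(k + 1)\<^sup>2 + annular_transfer k r = first_at_least ((k + 1)\<^sup>2) (k\<^sup>2 + r)"
proof -
  let ?n = "k\<^sup>2 + r"
  have n: "1 \<le> ?n" using assms(1) by (simp add: Suc_le_eq)
  have "first_at_least ((k + 1)\<^sup>2) ?n = (T ^^ exit_time k r) ?n"
    unfolding first_at_least_def
  proof (rule Least_equality)
    show "(k + 1)\<^sup>2 \<le> (T ^^ exit_time k r) ?n \<and> (\<exists>s. (T ^^ exit_time k r) ?n = (T ^^ s) ?n)"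
      using exit_time_props(2)[OF assms(1)] by blast
  next
    fix y assume "(k + 1)\<^sup>2 \<le> y \<and> (\<exists>s. y = (T ^^ s) ?n)"
    then obtain s where s: "(k + 1)\<^sup>2 \<le> y" "y = (T ^^ s) ?n" by blast
    with assms have "s \<noteq> 0" by (intro notI) simp
    with s have "exit_time k r \<le> s"
      unfolding exit_time_def by (intro Least_le) simp
    with s show "(T ^^ exit_time k r) ?n \<le> y"
      by (simp add: strict_mono_less_eq[OF strict_mono_T_funpow[OF n]])
  qed
  with exit_time_props(2)[OF assms(1), of r] show ?thesis
    by (simp add: annular_transfer_def)
qed

lemma shifted_S_eq:
  assumes "1 \<le> K"
  shows "(\<lambda>r. (K + t)\<^sup>2 + r) ` S K t = first_at_least ((K + t)\<^sup>2) ` {K\<^sup>2..<(K + 1)\<^sup>2}"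
proof (induction t)
  case 0
  have "first_at_least (K\<^sup>2) n = n" if "K\<^sup>2 \<le> n" for n
  proof -
    have n: "1 \<le> n" using that assms by (metis one_le_power order_trans)
    obtain s where "first_at_least (K\<^sup>2) n = (T ^^ s) n"
      using first_at_least_props(2)[OF n] by blast
    with T_iterate_ge[OF n, of s] first_at_least_le[of "K\<^sup>2" 0 n] that show ?thesis by simp
  qed
  then have "first_at_least (K\<^sup>2) ` {K\<^sup>2..<(K + 1)\<^sup>2} = {K\<^sup>2..<(K + 1)\<^sup>2}"
    by (intro trans[OF image_cong image_ident]) auto
  moreover have "{K\<^sup>2..<(K + 1)\<^sup>2} = (\<lambda>r. K\<^sup>2 + r) ` {0..2 * K}"
    by (auto simp: power2_eq_square image_add_atLeastAtMost)
  ultimately show ?case by (simp only: S.simps add_0_right)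
next
  case (Suc t)
  let ?k = "K + t"
  let ?I = "{K\<^sup>2..<(K + 1)\<^sup>2}"
  have I: "1 \<le> n" "n < (?k + 1)\<^sup>2" if "n \<in> ?I" for n
  proof -
    show "1 \<le> n" using that assms by (metis atLeastLessThan_iff one_le_power order_trans)
    have "(K + 1)\<^sup>2 \<le> (?k + 1)\<^sup>2" by (intro power_mono) auto
    with that show "n < (?k + 1)\<^sup>2" by (meson atLeastLessThan_iff less_le_trans)
  qed
  have "?k\<^sup>2 + r < (?k + 1)\<^sup>2" if "r \<in> S K t" for r
  proof -
    from that Suc.IH obtain n where "n \<in> ?I" "?k\<^sup>2 + r = first_at_least (?k\<^sup>2) n"
      by blast
    with first_at_least_less[OF I] show ?thesis by simp
  qed
  then have transfer: "(?k + 1)\<^sup>2 + annular_transfer ?k r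
      = first_at_least ((?k + 1)\<^sup>2) (?k\<^sup>2 + r)" if "r \<in> S K t" for r
    using annular_transfer_eq[of ?k r] assms that by simp
  have compose: "first_at_least ((?k + 1)\<^sup>2) (first_at_least (?k\<^sup>2) n)
      = first_at_least ((?k + 1)\<^sup>2) n" if n: "n \<in> ?I" for n
  proof -
    obtain s where "first_at_least (?k\<^sup>2) n = (T ^^ s) n"
      using first_at_least_props(2)[OF I(1)[OF n]] by blast
    with first_at_least_less[OF I[OF n]] first_at_least_funpow[OF I(1)[OF n]]
    show ?thesis by (metis less_imp_le)
  qed
  have "(\<lambda>r. (K + Suc t)\<^sup>2 + r) ` S K (Suc t)
      = (\<lambda>r. (?k + 1)\<^sup>2 + annular_transfer ?k r) ` S K t"
    by (simp add: image_image)
  also have "\<dots> = first_at_least ((?k + 1)\<^sup>2) ` (\<lambda>r. ?k\<^sup>2 + r) ` S K t"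
    unfolding image_image using transfer by (rule image_cong[OF refl])
  also have "\<dots> = first_at_least ((?k + 1)\<^sup>2) ` first_at_least (?k\<^sup>2) ` ?I"
    by (simp only: Suc.IH)
  also have "\<dots> = first_at_least ((?k + 1)\<^sup>2) ` ?I"
    unfolding image_image using compose by (rule image_cong[OF refl])
  finally show ?case by simp
qed

lemma card_S_eq:
  assumes "1 \<le> K"
  shows "card (S K t) = card (first_at_least ((K + t)\<^sup>2) ` {K\<^sup>2..<(K + 1)\<^sup>2})"
  unfolding shifted_S_eq[OF assms, symmetric] by (simp add: card_image)

text \<open>
  Pairwise meeting orbits have a common point for every finite set of starting points: given a
  point common to all orbits from \<open>F\<close>, follow its orbit until it meets the orbit of a new
  starting point.
\<close>

lemma finite_common_orbit_point:
  assumes meet: "\<forall>m n :: nat. m \<ge> 1 \<and> n \<ge> 1 \<longrightarrow> (\<exists>i j :: nat. (T ^^ i) m = (T ^^ j) n)"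
    and "finite F" "\<And>n. n \<in> F \<Longrightarrow> 1 \<le> n"
  shows "\<exists>p\<ge>1. \<forall>n\<in>F. \<exists>i. (T ^^ i) n = p"
  using assms(2,3)
proof (induction F rule: finite_induct)
  case empty
  show ?case by auto
next
  case (insert x F)
  then obtain p where p: "1 \<le> p" "\<forall>n\<in>F. \<exists>i. (T ^^ i) n = p" by auto
  with meet insert.prems obtain i j where ij: "(T ^^ i) x = (T ^^ j) p" by blast
  have "\<exists>l. (T ^^ l) n = (T ^^ j) p" if "n \<in> F" for n
    using p that by (metis comp_apply funpow_add)
  moreover have "1 \<le> (T ^^ j) p" using T_iterate_ge[OF p(1), of j] p(1) by simp
  ultimately show ?case using ij by blast
qed

theorem theorem4p4:
  shows "(\<forall>m n :: nat. m \<ge> 1 \<and> n \<ge> 1 \<longrightarrow> (\<exists>i j :: nat. (T ^^ i) m = (T ^^ j) n))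
     \<longleftrightarrow> (\<forall>K :: nat. K \<ge> 1 \<longrightarrow> (\<exists>t :: nat. card (S K t) = 1))"
proof (intro iffI allI impI)
  fix K :: nat
  assume meet: "\<forall>m n :: nat. m \<ge> 1 \<and> n \<ge> 1 \<longrightarrow> (\<exists>i j :: nat. (T ^^ i) m = (T ^^ j) n)"
    and K: "1 \<le> K"
  let ?I = "{K\<^sup>2..<(K + 1)\<^sup>2}"
  have I: "1 \<le> n" if "n \<in> ?I" for n
    using that K by (metis atLeastLessThan_iff one_le_power order_trans)
  obtain p where p: "\<And>n. n \<in> ?I \<Longrightarrow> \<exists>i. (T ^^ i) n = p"
    using finite_common_orbit_point[OF meet, of ?I] I by (meson finite_atLeastLessThan)
  \<comment> \<open>Any \<open>t\<close> with \<open>p \<le> (K + t)\<^sup>2\<close> will do, since the orbits coincide from \<open>p\<close> on.\<close>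
  let ?N = "(K + p)\<^sup>2"
  have "p \<le> ?N" by (simp add: power2_eq_square algebra_simps trans_le_add2)
  then have "first_at_least ?N n = first_at_least ?N p" if "n \<in> ?I" for n
    using p[OF that] first_at_least_funpow[OF I[OF that]] by metis
  moreover have "?I \<noteq> {}" by (simp add: power2_eq_square)
  ultimately have "first_at_least ?N ` ?I = {first_at_least ?N p}" by auto
  then have "card (S K p) = 1" by (simp add: card_S_eq[OF K])
  then show "\<exists>t. card (S K t) = 1" ..
next
  fix m n :: nat
  assume single: "\<forall>K :: nat. K \<ge> 1 \<longrightarrow> (\<exists>t :: nat. card (S K t) = 1)"
    and mn: "m \<ge> 1 \<and> n \<ge> 1"
  define K where "K = m + n"
  have K: "1 \<le> K" using mn by (simp add: K_def)
  let ?I = "{K\<^sup>2..<(K + 1)\<^sup>2}"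
  let ?e = "first_at_least (K\<^sup>2)"
  obtain t where "card (S K t) = 1" using single K by blast
  then obtain q where q: "first_at_least ((K + t)\<^sup>2) ` ?I = {q}"
    by (auto simp: card_S_eq[OF K] card_1_singleton_iff)
  have reach: "\<exists>s. (T ^^ s) x = q" if x: "1 \<le> x" "x \<le> K" for x
  proof -
    have "x < (K + 1)\<^sup>2" using x by (simp add: power2_eq_square)
    then have e: "?e x \<in> ?I"
      using first_at_least_props(1)[OF x(1)] first_at_least_less[OF x(1)] by simp
    then have "1 \<le> ?e x" using K by (metis atLeastLessThan_iff one_le_power order_trans)
    then obtain v where "first_at_least ((K + t)\<^sup>2) (?e x) = (T ^^ v) (?e x)"
      using first_at_least_props(2) by blast
    moreover have "first_at_least ((K + t)\<^sup>2) (?e x) = q" using q e by blast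
    moreover obtain u where "?e x = (T ^^ u) x" using first_at_least_props(2)[OF x(1)] by blast
    ultimately have "(T ^^ (v + u)) x = q" by (simp add: funpow_add)
    then show ?thesis ..
  qed
  have "\<exists>i. (T ^^ i) m = q" "\<exists>j. (T ^^ j) n = q"
    using reach mn by (simp_all add: K_def)
  then show "\<exists>i j. (T ^^ i) m = (T ^^ j) n" by metis
qed

end
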